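(* Let $\mathbb{F}_2$ be the field with two elements. (a) Let $Q=x^{2m}+\sum_{j=0}^{2m-1}\alpha_j x^j\in\mathbb{F}_2[x]$ be irreducible of even degree $l=2m$. If $\alpha_{2m-1}=1$, then both polynomials $Q(x+x^2)$ and $Q(1+x+x^2)$ are irreducible in $\mathbb{F}_2[x]$ of degree $2l$. If $\alpha_{2m-1}=0$, then each of the polynomials $Q(x+x^2)$ and $Q(1+x+x^2)$ factors in $\mathbb{F}_2[x]$ as a product of two irreducible polynomials of degree $l$ having the same trace. (b) Let $Q=x^{2m+1}+\sum_{j=0}^{2m}\alpha_j x^j\in\mathbb{F}_2[x]$ be irreducible of odd degree $l=2m+1$. Then the polynomial $Q(1+\alpha_{2m}+x+x^2)\in\mathbb{F}_2[x]$ is irreducible of degree $2l$, and the polynomial $Q(\alpha_{2m}+x+x^2)\in\mathbb{F}_2[x]$ factors as a product of two irreducible polynomials of degree $l$ having different traces.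
   Context: For $p$ prime and an irreducible polynomial $F=\sum_{j=0}^d\beta_jx^j\in\mathbb{F}_p[x]$ of degree $d$ dividing $l$, the relative trace is $\mathrm{tr}_l(F)=\sum_{k=0}^{l-1}\rho^{p^k}=-\frac{l}{d}\frac{\beta_{d-1}}{\beta_d}\in\mathbb{F}_p$, where $\rho\in\mathbb{F}_{p^l}$ is a root of $F$. In particular the trace of a monic irreducible polynomial of degree $l$ over $\mathbb{F}_2$ is its coefficient of $x^{l-1}$; "trace" of a degree-$l$ factor above means $\mathrm{tr}_l$ of it. $Q(R)$ denotes the composition $Q\circ R$. *)

theory Defs
  imports
    "HOL-Library.Z2"
    "HOL-Computational_Algebra.Polynomial"
    "HOL-Algebra.Algebraic_Closure_Type"
begin

text \<open>
  The field with two elements is the type \<^typ>\<open>bit\<close>.  The field with \<open>2 ^ l\<close> elements is regarded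
  as a subfield of the algebraic closure \<^typ>\<open>bit alg_closure\<close>: for an irreducible \<open>F\<close> whose degree
  divides \<open>l\<close> it contains every root of \<open>F\<close>.  The power sum below lies in the prime field and does
  not depend on the root; see \<open>rel_trace_root\<close> and \<open>rel_trace_coeff\<close>.
\<close>

definition rel_trace :: "nat \<Rightarrow> bit poly \<Rightarrow> bit" where
  "rel_trace l F =
     (THE t. \<forall>\<rho> :: bit alg_closure. poly (map_poly to_ac F) \<rho> = 0 \<longrightarrow>
        to_ac t = (\<Sum>k<l. \<rho> ^ (2 ^ k)))"

lemma bit_ac_double: "x + x = (0 :: bit alg_closure)"
proof -
  have "x + x = to_ac (1 + 1) * x"
    by (simp only: to_ac_add to_ac_1 distrib_right mult_1_left)
  also have "(1 + 1 :: bit) = 0"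
    by (simp only: one_add_one bit_2_eq_0)
  finally show ?thesis
    by (simp only: to_ac_0 mult_zero_left)
qed

lemma bit_ac_uminus: "- x = (x :: bit alg_closure)"
  by (rule minus_unique) (rule bit_ac_double)

lemma bit_ac_square_add: "(x + y) ^ 2 = x ^ 2 + (y :: bit alg_closure) ^ 2"
proof -
  have "(x + y) ^ 2 = x ^ 2 + y ^ 2 + (x * y + x * y)"
    by (simp add: power2_eq_square algebra_simps)
  thus ?thesis
    by (simp add: bit_ac_double)
qed

lemma bit_ac_square_inj: "x ^ 2 = y ^ 2 \<Longrightarrow> x = (y :: bit alg_closure)"
  by (auto simp: power2_eq_iff bit_ac_uminus)

lemma bit_ac_square_sum: "(\<Sum>x\<in>A. f x) ^ 2 = (\<Sum>x\<in>A. (f x :: bit alg_closure) ^ 2)"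
  by (induction A rule: infinite_finite_induct) (simp_all add: bit_ac_square_add)

lemma map_poly_square_mult:
  "map_poly (\<lambda>x. x ^ 2) (p * q) =
     map_poly (\<lambda>x. x ^ 2) p * map_poly (\<lambda>x. x ^ 2) (q :: bit alg_closure poly)"
  by (rule poly_eqI)
     (simp add: coeff_map_poly coeff_mult bit_ac_square_sum power_mult_distrib)

lemma map_poly_square_prod:
  "map_poly (\<lambda>x. x ^ 2) (\<Prod>k\<in>A. f k) =
     (\<Prod>k\<in>A. map_poly (\<lambda>x. x ^ 2) (f k :: bit alg_closure poly))"
  by (induction A rule: infinite_finite_induct) (simp_all add: map_poly_square_mult)

lemma map_poly_to_ac_add:
  "map_poly to_ac (p + q) = map_poly to_ac p + map_poly to_ac q"
  by (rule poly_eqI) (simp add: coeff_map_poly)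

lemma map_poly_to_ac_mult:
  "map_poly to_ac (p * q) = map_poly to_ac p * map_poly to_ac q"
  by (rule poly_eqI) (simp add: coeff_map_poly coeff_mult to_ac_sum)

lemma bit_power_two: "(c :: bit) ^ 2 = c"
  by (cases c) simp_all

lemma poly_to_ac_square:
  "poly (map_poly to_ac (F :: bit poly)) (x ^ 2) = poly (map_poly to_ac F) x ^ 2"
proof (induction F)
  case (pCons c F)
  have "to_ac c ^ 2 = to_ac c"
    by (simp only: bit_power_two flip: to_ac_power)
  thus ?case using pCons
    by (simp add: map_poly_pCons bit_ac_square_add power_mult_distrib)
qed simp

lemma coeff_prod_linear:
  fixes r :: "nat \<Rightarrow> 'a :: idom"
  shows "degree (\<Prod>k<n. [:- r k, 1:]) = n"
    and "coeff (\<Prod>k<n. [:- r k, 1:]) n = 1"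
    and "n > 0 \<Longrightarrow> coeff (\<Prod>k<n. [:- r k, 1:]) (n - 1) = - (\<Sum>k<n. r k)"
proof -
  show deg: "degree (\<Prod>k<n. [:- r k, 1:]) = n" for n
    by (subst degree_prod_sum_eq) auto
  show lead: "coeff (\<Prod>k<n. [:- r k, 1:]) n = 1" for n
    using lead_coeff_prod[of "\<lambda>k. [:- r k, 1:]" "{..<n}"] by (simp add: deg)
  show "n > 0 \<Longrightarrow> coeff (\<Prod>k<n. [:- r k, 1:]) (n - 1) = - (\<Sum>k<n. r k)"
  proof (induction n)
    case (Suc n)
    show ?case
    proof (cases n)
      case (Suc m)
      thus ?thesis using Suc.IH lead[of n] by (simp add: coeff_pCons mult.commute)
    qed simp
  qed simp
qed

lemma prod_linear_dvd:
  fixes p :: "'a :: idom poly"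
  assumes "finite A" "inj_on r A" "\<And>k. k \<in> A \<Longrightarrow> poly p (r k) = 0"
  shows "(\<Prod>k\<in>A. [:- r k, 1:]) dvd p"
  using assms
proof (induction A arbitrary: p rule: finite_induct)
  case (insert a A)
  obtain q where q: "p = [:- r a, 1:] * q"
    using insert.prems(2)[of a] by (auto simp: poly_eq_0_iff_dvd)
  have "poly q (r k) = 0" if "k \<in> A" for k
  proof -
    have "r k \<noteq> r a"
      using that insert.prems(1) insert.hyps by (auto simp: inj_on_def)
    moreover have "poly p (r k) = 0"
      using that insert.prems(2) by simp
    ultimately show ?thesis by (simp add: q)
  qed
  hence "(\<Prod>k\<in>A. [:- r k, 1:]) dvd q"
    using insert.IH insert.prems(1) by (auto simp: inj_on_def)
  hence "[:- r a, 1:] * (\<Prod>k\<in>A. [:- r k, 1:]) dvd p"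
    unfolding q by (rule mult_dvd_mono[OF dvd_refl])
  thus ?case
    by (simp only: prod.insert[OF insert.hyps])
qed simp

lemma power_two_Suc: "x ^ (2 ^ Suc k) = ((x :: 'a :: monoid_mult) ^ (2 ^ k)) ^ 2"
  by (simp only: power_Suc2 power_mult)

lemma bit_irreducible_split:
  fixes F :: "bit poly" and \<rho> :: "bit alg_closure"
  assumes F: "irreducible F" and \<rho>: "poly (map_poly to_ac F) \<rho> = 0"
  shows "map_poly to_ac F = (\<Prod>k<degree F. [:- (\<rho> ^ (2 ^ k)), 1:])"
    and "\<rho> ^ (2 ^ degree F) = \<rho>"
    and "degree F > 0"
proof -
  define F' where "F' = map_poly to_ac F"
  define r where "r k = \<rho> ^ (2 ^ k)" for k :: nat
  have r0: "r 0 = \<rho>" by (simp add: r_def)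
  have rSuc: "r (Suc k) = r k ^ 2" for k
    by (simp only: r_def power_two_Suc)
  have F0: "F \<noteq> 0" using F by auto
  hence F'0: "F' \<noteq> 0" by (simp add: F'_def map_poly_eq_0_iff)
  have root: "poly F' (r k) = 0" for k
    by (induction k) (use \<rho> in \<open>simp_all add: r0 rSuc F'_def poly_to_ac_square\<close>)
  have "finite (range r)"
    by (rule finite_subset[OF _ poly_roots_finite[OF F'0]]) (use root in auto)
  hence "\<not> inj r" using finite_imageD by blast
  then obtain i j where ij: "i < j" "r i = r j"
    by (metis injI linorder_neqE_nat)
  have cancel: "r i = r j \<Longrightarrow> i \<le> j \<Longrightarrow> r (j - i) = \<rho>" for i j
  proof (induction i arbitrary: j)
    case (Suc i)
    obtain j' where "j = Suc j'" using Suc.prems by (cases j) auto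
    thus ?case using Suc by (auto simp: rSuc dest!: bit_ac_square_inj)
  qed (simp add: r0)
  define e where "e = (LEAST e. e > 0 \<and> r e = \<rho>)"
  have ex: "j - i > 0 \<and> r (j - i) = \<rho>" using ij cancel[of i j] by auto
  have e: "e > 0" "r e = \<rho>"
    using LeastI[of "\<lambda>e. e > 0 \<and> r e = \<rho>", OF ex] by (auto simp: e_def)
  have emin: "e \<le> k" if "k > 0" "r k = \<rho>" for k
    unfolding e_def by (rule Least_le) (use that in auto)
  have no: False if "a < b" "b < e" "r a = r b" for a b
    using cancel[of a b] emin[of "b - a"] that by auto
  have inj: "inj_on r {..<e}"
  proof (rule inj_onI)
    fix a b assume "a \<in> {..<e}" "b \<in> {..<e}" "r a = r b"
    thus "a = b" using no[of a b] no[of b a] by (cases a b rule: linorder_cases) auto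
  qed
  define g where "g = (\<Prod>k<e. [:- r k, 1:])"
  have g_dvd: "g dvd F'"
    unfolding g_def by (rule prod_linear_dvd) (use inj root in auto)
  have "map_poly (\<lambda>x. x ^ 2) g = (\<Prod>k<e. [:- r (Suc k), 1:])"
    unfolding g_def map_poly_square_prod
    by (intro prod.cong refl) (simp add: map_poly_pCons rSuc bit_ac_uminus)
  also have "\<dots> = g"
  proof -
    obtain e' where e': "e = Suc e'" using e(1) by (cases e) auto
    have "(\<Prod>k<e. [:- r (Suc k), 1:]) = (\<Prod>k<e'. [:- r (Suc k), 1:]) * [:- r e, 1:]"
      by (simp add: e' mult.commute)
    also have "\<dots> = [:- r 0, 1:] * (\<Prod>k<e'. [:- r (Suc k), 1:])"
      by (simp only: e(2) r0 mult.commute)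
    also have "\<dots> = g"
      unfolding g_def e' by (simp only: prod.lessThan_Suc_shift)
    finally show ?thesis .
  qed
  finally have frob: "map_poly (\<lambda>x. x ^ 2) g = g" .
  have "coeff g n \<in> range to_ac" for n
  proof -
    have "coeff g n ^ 2 = coeff g n"
      by (subst (2) frob[symmetric]) (simp add: coeff_map_poly)
    hence "coeff g n = to_ac 0 \<or> coeff g n = to_ac 1"
      by (auto simp: power2_eq_square)
    thus ?thesis by blast
  qed
  hence g_eq: "map_poly to_ac (map_poly of_ac g) = g"
    by (intro poly_eqI) (simp add: coeff_map_poly to_ac_of_ac)
  obtain h where gh: "map_poly to_ac h = g"
    using g_eq by blast
  have degh: "degree h = e"
  proof -
    have "degree g = degree h"
      by (simp add: degree_map_poly flip: gh)
    thus ?thesis by (simp add: g_def coeff_prod_linear)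
  qed
  have "F mod h = 0"
  proof (rule ccontr)
    assume nz: "F mod h \<noteq> 0"
    define q where "q = F div h"
    have "F = h * q + F mod h" by (simp add: q_def)
    hence "F' = map_poly to_ac (h * q + F mod h)" by (simp add: F'_def)
    hence "F' = g * map_poly to_ac q + map_poly to_ac (F mod h)"
      by (simp only: map_poly_to_ac_add map_poly_to_ac_mult gh)
    hence "g dvd map_poly to_ac (F mod h)"
      using g_dvd by (metis dvd_add_right_iff dvd_triv_left)
    hence "degree g \<le> degree (map_poly to_ac (F mod h))"
      by (rule dvd_imp_degree_le) (use nz in \<open>simp add: map_poly_eq_0_iff\<close>)
    also have "\<dots> = degree (F mod h)" by (simp add: degree_map_poly)
    also have "\<dots> < degree h"
    proof -
      have "h \<noteq> 0" using degh e(1) by auto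
      thus ?thesis using degree_mod_less[of h F] nz by blast
    qed
    also have "\<dots> = degree g" by (simp add: degh g_def coeff_prod_linear)
    finally show False by simp
  qed
  then obtain q where q: "F = h * q" by (auto simp: mod_eq_0_iff_dvd)
  have "\<not> h dvd 1" using degh e(1) by (auto simp: is_unit_poly_iff)
  hence "q dvd 1" using irreducibleD[OF F q] by auto
  then obtain c where "q = [:c:]" "c \<noteq> 0" by (auto simp: is_unit_poly_iff)
  hence "q = 1" by (cases c) (simp_all add: one_pCons)
  hence Fh: "F = h" by (simp add: q)
  show "map_poly to_ac F = (\<Prod>k<degree F. [:- (\<rho> ^ (2 ^ k)), 1:])"
    unfolding Fh degh gh by (simp only: g_def r_def)
  show "\<rho> ^ (2 ^ degree F) = \<rho>" using e by (simp add: Fh degh r_def)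
  show "degree F > 0" using e by (simp add: Fh degh)
qed

lemma bit_power_sum_root:
  fixes F :: "bit poly" and \<rho> :: "bit alg_closure"
  assumes F: "irreducible F" and dvd: "degree F dvd l" and \<rho>: "poly (map_poly to_ac F) \<rho> = 0"
  shows "(\<Sum>k<l. \<rho> ^ (2 ^ k)) =
           to_ac (- of_nat (l div degree F) * (coeff F (degree F - 1) / coeff F (degree F)))"
proof -
  define d where "d = degree F"
  define r where "r k = \<rho> ^ (2 ^ k)" for k :: nat
  have split: "map_poly to_ac F = (\<Prod>k<d. [:- r k, 1:])" and rd: "r d = \<rho>" and d: "d > 0"
    using bit_irreducible_split[OF F \<rho>] by (auto simp: r_def d_def)
  have rSuc: "r (Suc k) = r k ^ 2" for k by (simp only: r_def power_two_Suc)
  have per: "r (k + d) = r k" for k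
    by (induction k) (simp_all add: rSuc rd, simp add: r_def)
  have per': "r (m * d + k) = r k" for m k
  proof (induction m)
    case (Suc m)
    have "r (Suc m * d + k) = r ((m * d + k) + d)" by (simp add: algebra_simps)
    thus ?case using Suc by (simp only: per)
  qed simp
  have lead: "coeff F d = 1"
    using F by (cases "coeff F d") (auto simp: d_def)
  have c: "(\<Sum>k<d. r k) = - to_ac (coeff F (d - 1))"
    using arg_cong[OF split, of "\<lambda>p. coeff p (d - 1)"] coeff_prod_linear(3)[OF d, of r]
    by (simp add: coeff_map_poly)
  have "(\<Sum>k<m * d. r k) = of_nat m * (\<Sum>k<d. r k)" for m
  proof (induction m)
    case (Suc m)
    have "(\<Sum>k<Suc m * d. r k) = (\<Sum>k<m * d + d. r k)"
      by (simp add: algebra_simps)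
    also have "\<dots> = (\<Sum>k<m * d. r k) + (\<Sum>k<d. r (m * d + k))"
      using sum.atLeastLessThan_concat[of 0 "m * d" "m * d + d" r]
        sum.shift_bounds_nat_ivl[of r 0 "m * d" d]
      by (simp add: lessThan_atLeast0 add.commute)
    also have "\<dots> = of_nat (Suc m) * (\<Sum>k<d. r k)"
      unfolding Suc per' by (simp add: algebra_simps)
    finally show ?case .
  qed simp
  from this[of "l div d"] have "(\<Sum>k<l. r k) = of_nat (l div d) * (\<Sum>k<d. r k)"
    using dvd by (simp add: d_def)
  also have "\<dots> = to_ac (- of_nat (l div d) * (coeff F (d - 1) / coeff F d))"
    by (simp only: c lead to_ac_mult to_ac_minus to_ac_of_nat div_by_1
        mult_minus_left mult_minus_right)
  finally show ?thesis
    by (simp only: r_def d_def)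
qed

lemma rel_trace_coeff:
  assumes "irreducible F" "degree F dvd l"
  shows "rel_trace l F =
           - of_nat (l div degree F) * (coeff F (degree F - 1) / coeff F (degree F))"
proof -
  have "degree F > 0"
  proof (rule ccontr)
    assume "\<not> degree F > 0"
    then obtain c where c: "F = [:c:]" by (auto elim: degree_eq_zeroE)
    thus False using assms(1) by (cases c) (simp_all add: flip: one_pCons)
  qed
  hence "degree (map_poly to_ac F) > 0" by (simp add: degree_map_poly)
  then obtain \<rho> :: "bit alg_closure" where \<rho>: "poly (map_poly to_ac F) \<rho> = 0"
    using alg_closed_imp_poly_has_root by blast
  show ?thesis
    unfolding rel_trace_def
  proof (rule the_equality)
    fix t
    assume "\<forall>\<rho> :: bit alg_closure. poly (map_poly to_ac F) \<rho> = 0 \<longrightarrow>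
              to_ac t = (\<Sum>k<l. \<rho> ^ (2 ^ k))"
    hence "to_ac t = (\<Sum>k<l. \<rho> ^ (2 ^ k))" using \<rho> by blast
    thus "t = - of_nat (l div degree F) * (coeff F (degree F - 1) / coeff F (degree F))"
      by (simp only: bit_power_sum_root[OF assms \<rho>] to_ac_eq_iff)
  qed (metis bit_power_sum_root[OF assms])
qed

lemma rel_trace_root:
  assumes "irreducible F" "degree F dvd l" "poly (map_poly to_ac F) \<rho> = 0"
  shows "to_ac (rel_trace l F) = (\<Sum>k<l. \<rho> ^ (2 ^ k))"
  using bit_power_sum_root[OF assms] rel_trace_coeff[OF assms(1,2)] by simp

end

theory Submission
  imports Defs
begin

text \<open>
  Let \<open>\<rho>\<close> be a root of \<open>Q(c + x + x\<^sup>2)\<close>, where \<open>Q\<close> is irreducible of degree \<open>l\<close>, and let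
  \<open>\<sigma> = c + \<rho> + \<rho>\<^sup>2\<close> be the corresponding root of \<open>Q\<close>.  Telescoping \<open>\<rho> + \<rho>\<^sup>2 = \<sigma> + c\<close> along the
  Frobenius gives \<open>\<rho> ^ (2 ^ l) = \<rho> + t\<close> with \<open>t = tr(\<sigma> + c) = tr(\<sigma>) + l c\<close> in the prime field.
  The degree of \<open>\<rho>\<close> is its period under the Frobenius, hence a multiple of the period \<open>l\<close> of \<open>\<sigma>\<close>.
  Being at most \<open>2 l\<close>, it is \<open>2 l\<close> if \<open>t = 1\<close> and \<open>l\<close> if \<open>t = 0\<close>.  In the second case the two
  factors of degree \<open>l\<close> have traces summing to the coefficient of \<open>x ^ (2 l - 1)\<close> in
  \<open>Q(c + x + x\<^sup>2)\<close>, which is \<open>l\<close> modulo 2.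
\<close>

subsection \<open>The coefficient below the leading one\<close>

definition next_coeff :: "'a::zero poly \<Rightarrow> 'a" where
  "next_coeff p = (if degree p = 0 then 0 else coeff p (degree p - 1))"

lemma coeff_Suc_0_reflect_poly: "coeff (reflect_poly p) (Suc 0) = next_coeff p"
  by (simp add: next_coeff_def coeff_reflect_poly)

lemma next_coeff_mult:
  fixes p q :: "'a::{comm_semiring_0, semiring_no_zero_divisors} poly"
  shows "next_coeff (p * q) = lead_coeff p * next_coeff q + next_coeff p * lead_coeff q"
proof -
  have "coeff (reflect_poly p * reflect_poly q) (Suc 0) =
          lead_coeff p * next_coeff q + next_coeff p * lead_coeff q"
    by (simp add: coeff_mult coeff_Suc_0_reflect_poly)
  thus ?thesis
    by (simp only: coeff_Suc_0_reflect_poly flip: reflect_poly_mult)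
qed

lemma next_coeff_add_const:
  fixes p :: "'a::comm_monoid_add poly"
  assumes "degree p \<noteq> 1"
  shows "next_coeff ([:a:] + p) = next_coeff p"
proof (cases "degree p = 0")
  case True
  hence "degree ([:a:] + p) = 0"
    using degree_add_le[of "[:a:]" 0 p] by simp
  thus ?thesis
    using True by (simp add: next_coeff_def)
next
  case False
  hence "degree ([:a:] + p) = degree p"
    by (intro degree_add_eq_right) simp
  moreover have "coeff [:a:] (degree p - 1) = 0"
    using assms False by (intro coeff_eq_0) simp
  ultimately show ?thesis
    by (simp add: next_coeff_def)
qed

lemma next_coeff_pcompose:
  fixes p q :: "'a::{comm_semiring_1, semiring_no_zero_divisors} poly"
  assumes q: "degree q > 1"
  shows "next_coeff (p \<circ>\<^sub>p q) =
           of_nat (degree p) * lead_coeff p * lead_coeff q ^ (degree p - 1) * next_coeff q"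
proof (induction p)
  case 0
  show ?case by (simp add: next_coeff_def)
next
  case (pCons a p)
  show ?case
  proof (cases "p = 0")
    case True
    thus ?thesis by (simp add: pcompose_pCons next_coeff_def)
  next
    case False
    have "q \<noteq> 0"
      using q by auto
    hence "degree (q * (p \<circ>\<^sub>p q)) \<noteq> 1"
      using q by (cases "p \<circ>\<^sub>p q = 0") (simp_all add: degree_mult_eq)
    hence "next_coeff (pCons a p \<circ>\<^sub>p q) = next_coeff (q * (p \<circ>\<^sub>p q))"
      by (simp add: pcompose_pCons next_coeff_add_const)
    also have "\<dots> = lead_coeff q * next_coeff (p \<circ>\<^sub>p q) +
                      next_coeff q * (lead_coeff p * lead_coeff q ^ degree p)"
      using q by (simp add: next_coeff_mult lead_coeff_comp)
    also have "\<dots> = of_nat (Suc (degree p)) * lead_coeff p * lead_coeff q ^ degree p * next_coeff q"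
      unfolding pCons.IH by (cases "degree p") (simp_all add: algebra_simps)
    finally show ?thesis
      using False by simp
  qed
qed

lemma coeff_monom_add_lower_terms:
  "coeff (monom (1::'a::comm_semiring_1) n + (\<Sum>j<n. monom (\<alpha> j) j)) i =
     (if i = n then 1 else if i < n then \<alpha> i else 0)"
  by (simp add: coeff_sum)

lemma degree_monom_add_lower_terms:
  "degree (monom (1::'a::comm_semiring_1) n + (\<Sum>j<n. monom (\<alpha> j) j)) = n"
proof (rule antisym)
  show "degree (monom (1::'a) n + (\<Sum>j<n. monom (\<alpha> j) j)) \<le> n"
    by (rule degree_le) (simp add: coeff_monom_add_lower_terms del: coeff_add)
  show "n \<le> degree (monom (1::'a) n + (\<Sum>j<n. monom (\<alpha> j) j))"
    by (rule le_degree) (simp add: coeff_monom_add_lower_terms del: coeff_add)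
qed

lemma next_coeff_monom_add_lower_terms:
  assumes "n > 0"
  shows "next_coeff (monom (1::'a::comm_semiring_1) n + (\<Sum>j<n. monom (\<alpha> j) j)) = \<alpha> (n - 1)"
  using assms
  by (simp add: next_coeff_def degree_monom_add_lower_terms coeff_monom_add_lower_terms
      del: coeff_add)

subsection \<open>Irreducible polynomials over a field and their roots\<close>

lemma field_poly_irreducible_degree_pos:
  fixes p :: "'a::field poly"
  assumes "irreducible p"
  shows "degree p > 0"
  using assms irreducible_not_unit[of p] is_unit_iff_degree[of p] by fastforce

lemma field_poly_irreducible_factor_exists:
  fixes p :: "'a::field poly"
  assumes "degree p > 0"
  obtains q where "irreducible q" "q dvd p"
proof -
  obtain q where q: "q dvd p" "degree q > 0"
    and min: "\<And>r. r dvd p \<Longrightarrow> degree r > 0 \<Longrightarrow> degree q \<le> degree r"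
    using ex_has_least_nat[of "\<lambda>q. q dvd p \<and> degree q > 0" p degree] assms by auto
  have "irreducible q"
  proof (rule irreducibleI)
    show "q \<noteq> 0"
      using q(2) by auto
    thus "\<not> is_unit q"
      using q(2) by (simp add: is_unit_iff_degree)
    show "is_unit a \<or> is_unit b" if ab: "q = a * b" for a b
    proof -
      have nonzero: "a \<noteq> 0" "b \<noteq> 0"
        using ab \<open>q \<noteq> 0\<close> by auto
      hence "degree q = degree a + degree b"
        by (simp add: ab degree_mult_eq)
      moreover have "a dvd p"
        using q(1) ab by (auto dest: dvd_mult_left)
      hence "degree a = 0 \<or> degree q \<le> degree a"
        using min by blast
      ultimately have "degree a = 0 \<or> degree b = 0"
        by auto
      thus ?thesis
        using nonzero by (simp add: is_unit_iff_degree)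
    qed
  qed
  thus thesis
    using q(1) that by blast
qed

lemma field_poly_irreducibleI_factor_degree:
  fixes p :: "'a::field poly"
  assumes deg: "degree p > 0"
    and factors: "\<And>q. irreducible q \<Longrightarrow> q dvd p \<Longrightarrow> degree q = degree p"
  shows "irreducible p"
proof -
  obtain q where q: "irreducible q" "q dvd p"
    using field_poly_irreducible_factor_exists[OF deg] .
  then obtain u where u: "p = u * q"
    by (metis dvdE mult.commute)
  hence "u \<noteq> 0" "q \<noteq> 0"
    using deg by auto
  hence "is_unit u"
    using factors[OF q] by (simp add: u degree_mult_eq is_unit_iff_degree)
  thus ?thesis
    using q(1) by (simp add: u irreducible_mult_unit_left)
qed

abbreviation poly_ac :: "'a::field poly \<Rightarrow> 'a alg_closure \<Rightarrow> 'a alg_closure" where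
  "poly_ac p \<equiv> poly (map_poly to_ac p)"

lemma poly_ac_pcompose: "poly_ac (p \<circ>\<^sub>p q) x = poly_ac p (poly_ac q x)"
  by (induction p)
     (simp_all add: pcompose_pCons map_poly_pCons map_poly_to_ac_add map_poly_to_ac_mult)

lemma poly_ac_has_root:
  assumes "degree p > 0"
  obtains x where "poly_ac p x = 0"
proof -
  have "degree (map_poly to_ac p) > 0"
    using assms by (simp add: degree_map_poly)
  thus thesis
    using alg_closed_imp_poly_has_root that by blast
qed

lemma poly_ac_root_of_dvd:
  assumes "p dvd q" "poly_ac p x = 0"
  shows "poly_ac q x = 0"
  using assms by (auto simp: map_poly_to_ac_mult elim!: dvdE)

lemma poly_ac_annihilator_principal:
  obtains m where "\<And>p. poly_ac p x = 0 \<longleftrightarrow> m dvd p"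
proof -
  obtain p0 where "p0 \<noteq> 0" "poly_ac p0 x = 0"
    using alg_closure_algebraic .
  then obtain m where m: "m \<noteq> 0" "poly_ac m x = 0"
    and min: "\<And>p. p \<noteq> 0 \<Longrightarrow> poly_ac p x = 0 \<Longrightarrow> degree m \<le> degree p"
    using ex_has_least_nat[of "\<lambda>p. p \<noteq> 0 \<and> poly_ac p x = 0" p0 degree] by blast
  have "m dvd p" if "poly_ac p x = 0" for p
  proof -
    have "map_poly to_ac p = map_poly to_ac m * map_poly to_ac (p div m) + map_poly to_ac (p mod m)"
      by (simp flip: map_poly_to_ac_mult map_poly_to_ac_add)
    hence "poly_ac (p mod m) x = 0"
      using that m(2) by simp
    hence "p mod m = 0"
      using min[of "p mod m"] degree_mod_less[OF m(1), of p] by fastforce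
    thus ?thesis
      by (simp add: mod_eq_0_iff_dvd)
  qed
  thus thesis
    using m(2) poly_ac_root_of_dvd that by blast
qed

lemma irreducible_dvd_iff_common_root:
  assumes p: "irreducible p" "poly_ac p x = 0"
  shows "p dvd q \<longleftrightarrow> poly_ac q x = 0"
proof -
  obtain m where m: "\<And>q. poly_ac q x = 0 \<longleftrightarrow> m dvd q"
    using poly_ac_annihilator_principal[of x] by blast
  have "\<not> is_unit m"
    using m[of 1] by simp
  hence "p dvd m"
    using irreducibleD'[OF p(1)] m p(2) by blast
  thus ?thesis
    using m p(2) dvd_trans by blast
qed

subsection \<open>Traces and the Frobenius\<close>

definition frob_trace :: "nat \<Rightarrow> 'a::comm_semiring_1 \<Rightarrow> 'a" where
  "frob_trace n x = (\<Sum>k<n. x ^ (CHAR('a) ^ k))"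

lemma frob_trace_add:
  fixes x y :: "'a::comm_semiring_1"
  assumes "prime CHAR('a)"
  shows "frob_trace n (x + y) = frob_trace n x + frob_trace n y"
  by (simp add: frob_trace_def freshmans_dream'[OF assms refl] sum.distrib)

lemma frob_trace_artin_schreier:
  fixes x :: "'a::comm_ring_1"
  assumes "prime CHAR('a)"
  shows "frob_trace n (x ^ CHAR('a) - x) = x ^ (CHAR('a) ^ n) - x"
proof -
  have "frob_trace n (x ^ CHAR('a) - x) = frob_trace n (x ^ CHAR('a)) - frob_trace n x"
    using frob_trace_add[OF assms, of n "x ^ CHAR('a) - x" x] by simp
  also have "\<dots> = (\<Sum>k<n. x ^ (CHAR('a) ^ Suc k) - x ^ (CHAR('a) ^ k))"
    by (simp add: frob_trace_def sum_subtractf flip: power_mult)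
  also have "\<dots> = x ^ (CHAR('a) ^ n) - x"
    using sum_lessThan_telescope[of "\<lambda>k. x ^ (CHAR('a) ^ k)" n] by simp
  finally show ?thesis .
qed

lemma CHAR_bit [simp]: "CHAR(bit) = 2"
  by (rule CHAR_eqI) (simp, metis even_of_nat_iff even_zero)

lemma bit_lead_coeff: "p \<noteq> 0 \<Longrightarrow> lead_coeff (p :: bit poly) = 1"
  by (cases "lead_coeff p") simp_all

lemma rel_trace_degree:
  assumes "irreducible F"
  shows "rel_trace (degree F) F = next_coeff F"
proof -
  have "F \<noteq> 0" and "degree F > 0"
    using assms field_poly_irreducible_degree_pos by auto
  thus ?thesis
    using rel_trace_coeff[OF assms dvd_refl] bit_lead_coeff by (simp add: next_coeff_def)
qed

lemma power_two_power_eq_funpow: "x ^ (2 ^ n) = ((\<lambda>y. y ^ 2) ^^ n) (x :: 'a::monoid_mult)"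
  by (induction n) (simp_all add: power_two_Suc del: power_Suc)

lemma poly_ac_frobenius:
  fixes p :: "bit poly"
  shows "poly_ac p (x ^ (2 ^ n)) = poly_ac p x ^ (2 ^ n)"
  by (induction n) (simp_all only: power_two_Suc poly_to_ac_square power_0 power_one_right)

lemma bit_irreducible_conjugates_distinct:
  fixes F :: "bit poly"
  assumes F: "irreducible F" "poly_ac F x = 0" and n: "0 < n" "n < degree F"
  shows "x ^ (2 ^ n) \<noteq> x"
proof
  \<comment> \<open>A coincidence among the conjugates makes \<open>x\<close> a double root of \<open>X ^ (2 ^ n) + X\<close>, whose
    derivative is \<open>1\<close>.\<close>
  assume fixed: "x ^ (2 ^ n) = x"
  define G :: "bit poly" where "G = monom 1 (2 ^ n) + monom 1 1"
  define G' where "G' = map_poly to_ac G"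
  have G': "G' = monom 1 (2 ^ n) + monom 1 1"
    by (simp add: G'_def G_def map_poly_to_ac_add map_poly_monom)
  have "poly_ac G x = 0"
    using fixed G' by (simp add: poly_monom bit_ac_double flip: G'_def)
  hence "F dvd G"
    using irreducible_dvd_iff_common_root[OF F] by blast
  hence "map_poly to_ac F dvd G'"
    by (auto simp: G'_def map_poly_to_ac_mult elim!: dvdE)
  moreover have "(\<Prod>k\<in>{0, n}. [:- (x ^ (2 ^ k)), 1:]) dvd map_poly to_ac F"
    unfolding bit_irreducible_split(1)[OF F] using n by (intro prod_dvd_prod_subset) auto
  ultimately have "[:- x, 1:] * [:- x, 1:] dvd G'"
    using n fixed by (auto dest: dvd_trans)
  then obtain H where H: "G' = [:- x, 1:] * ([:- x, 1:] * H)"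
    by (metis dvdE mult.assoc)
  have "poly (pderiv G') x = 0"
    unfolding H by (subst pderiv_mult) simp
  moreover have "poly (pderiv G') x = 2 ^ n * x ^ (2 ^ n - 1) + 1"
    by (simp add: G' pderiv_add pderiv_monom poly_monom)
  moreover have "(2 :: bit alg_closure) = 0"
    using bit_ac_double[of 1] by simp
  ultimately show False
    using n by (simp add: power_0_left)
qed

lemma bit_irreducible_root_frobenius_iff:
  fixes F :: "bit poly"
  assumes F: "irreducible F" "poly_ac F x = 0"
  shows "x ^ (2 ^ n) = x \<longleftrightarrow> degree F dvd n"
proof -
  have "x ^ (2 ^ n) = x ^ (2 ^ (n mod degree F))"
    using bit_irreducible_split(2)[OF F] unfolding power_two_power_eq_funpow
    by (simp add: funpow_mod_eq)
  moreover have "x ^ (2 ^ (n mod degree F)) = x \<longleftrightarrow> n mod degree F = 0"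
    using bit_irreducible_conjugates_distinct[OF F, of "n mod degree F"]
      field_poly_irreducible_degree_pos[OF F(1)] by fastforce
  ultimately show ?thesis
    by (simp add: mod_eq_0_iff_dvd)
qed

lemma bit_degree_dvd_degree_factor_pcompose:
  fixes Q R F :: "bit poly"
  assumes Q: "irreducible Q" and F: "irreducible F" "F dvd Q \<circ>\<^sub>p R"
  shows "degree Q dvd degree F"
proof -
  obtain x where x: "poly_ac F x = 0"
    using poly_ac_has_root field_poly_irreducible_degree_pos[OF F(1)] .
  hence root: "poly_ac Q (poly_ac R x) = 0"
    using poly_ac_root_of_dvd[OF F(2)] by (simp add: poly_ac_pcompose)
  have "poly_ac R x ^ (2 ^ degree F) = poly_ac R x"
    by (simp only: bit_irreducible_split(2)[OF F(1) x] flip: poly_ac_frobenius)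
  thus ?thesis
    using bit_irreducible_root_frobenius_iff[OF Q root] by blast
qed

subsection \<open>The substitution of \<open>c + x + x\<^sup>2\<close>\<close>

definition shifted_trace :: "bit poly \<Rightarrow> bit \<Rightarrow> bit" where
  "shifted_trace Q c = rel_trace (degree Q) Q + of_nat (degree Q) * c"

lemma frob_trace_root_add_const:
  assumes "irreducible Q" "poly_ac Q \<sigma> = 0"
  shows "frob_trace (degree Q) (\<sigma> + to_ac c) = to_ac (shifted_trace Q c)"
proof -
  have "to_ac c ^ (2 ^ k) = to_ac c" for k :: nat
    by (cases c) simp_all
  hence "frob_trace n (to_ac c) = to_ac (of_nat n * c)" for n
    by (simp only: frob_trace_def CHAR_alg_closure CHAR_bit sum_constant card_lessThan
        to_ac_mult to_ac_of_nat)
  moreover have "frob_trace (degree Q) \<sigma> = to_ac (rel_trace (degree Q) Q)"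
    using rel_trace_root[OF assms(1) dvd_refl assms(2)] by (simp add: frob_trace_def)
  ultimately show ?thesis
    by (simp only: frob_trace_add CHAR_alg_closure CHAR_bit two_is_prime_nat shifted_trace_def
        to_ac_add)
qed

lemma artin_schreier_root_frobenius:
  assumes Q: "irreducible Q" and x: "poly_ac (Q \<circ>\<^sub>p [:c, 1, 1:]) x = 0"
  shows "x ^ (2 ^ degree Q) = x + to_ac (shifted_trace Q c)"
proof -
  define \<sigma> where "\<sigma> = poly_ac [:c, 1, 1:] x"
  have "\<sigma> = (x ^ 2 - x) + to_ac c"
    by (simp add: \<sigma>_def map_poly_pCons power2_eq_square algebra_simps bit_ac_uminus
        diff_conv_add_uminus del: add_uminus_conv_diff)
  hence "x ^ 2 - x = \<sigma> + to_ac c"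
    by (simp add: add.assoc bit_ac_double)
  moreover have "frob_trace (degree Q) (\<sigma> + to_ac c) = to_ac (shifted_trace Q c)"
    by (rule frob_trace_root_add_const[OF Q]) (use x in \<open>simp add: \<sigma>_def poly_ac_pcompose\<close>)
  ultimately have "x ^ (2 ^ degree Q) - x = to_ac (shifted_trace Q c)"
    using frob_trace_artin_schreier[of "degree Q" x] by simp
  thus ?thesis
    by (simp add: algebra_simps)
qed

lemma degree_factor_artin_schreier_compose:
  assumes Q: "irreducible Q" and F: "irreducible F" "F dvd Q \<circ>\<^sub>p [:c, 1, 1:]"
  shows "degree F = (if shifted_trace Q c = 0 then degree Q else 2 * degree Q)"
proof -
  obtain x where x: "poly_ac F x = 0"
    using poly_ac_has_root field_poly_irreducible_degree_pos[OF F(1)] .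
  have "x ^ (2 ^ degree Q) = x + to_ac (shifted_trace Q c)"
    using artin_schreier_root_frobenius[OF Q] poly_ac_root_of_dvd[OF F(2) x] .
  hence dvd_iff: "degree F dvd degree Q \<longleftrightarrow> shifted_trace Q c = 0"
    using bit_irreducible_root_frobenius_iff[OF F(1) x, of "degree Q"] by simp
  have Q_pos: "degree Q > 0" and F_pos: "degree F > 0"
    using Q F(1) field_poly_irreducible_degree_pos by blast+
  obtain k where k: "degree F = degree Q * k"
    using bit_degree_dvd_degree_factor_pcompose[OF Q F] by (elim dvdE)
  have "degree F \<le> 2 * degree Q"
    using dvd_imp_degree_le[OF F(2)] Q_pos by (force simp: degree_pcompose pcompose_eq_0_iff)
  hence "k = 1 \<or> k = 2"
    using k Q_pos F_pos by auto
  thus ?thesis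
    using k dvd_iff Q_pos by auto
qed

lemma irreducible_artin_schreier_compose:
  assumes Q: "irreducible Q" and trace: "shifted_trace Q c \<noteq> 0"
  shows "irreducible (Q \<circ>\<^sub>p [:c, 1, 1:])"
  using degree_factor_artin_schreier_compose[OF Q] trace field_poly_irreducible_degree_pos[OF Q]
  by (intro field_poly_irreducibleI_factor_degree) (simp_all add: degree_pcompose)

lemma rel_trace_sum_artin_schreier_factors:
  assumes Q: "irreducible Q" and FG: "Q \<circ>\<^sub>p [:c, 1, 1:] = F * G"
    and F: "irreducible F" and G: "irreducible G"
  shows "rel_trace (degree F) F + rel_trace (degree G) G = of_nat (degree Q)"
proof -
  have nonzero: "Q \<noteq> 0" "F \<noteq> 0" "G \<noteq> 0"
    using Q F G by auto
  have "next_coeff (F * G) = next_coeff F + next_coeff G"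
    by (simp only: next_coeff_mult nonzero(2,3)[THEN bit_lead_coeff] mult_1_left mult_1_right
        add.commute)
  moreover have "next_coeff (Q \<circ>\<^sub>p [:c, 1, 1:]) = of_nat (degree Q)"
    using nonzero by (simp add: next_coeff_pcompose bit_lead_coeff next_coeff_def[of "[:c, 1, 1:]"])
  ultimately show ?thesis
    using F G FG by (simp add: rel_trace_degree)
qed

lemma artin_schreier_compose_splits:
  assumes Q: "irreducible Q" and trace: "shifted_trace Q c = 0"
  shows "\<exists>F G. Q \<circ>\<^sub>p [:c, 1, 1:] = F * G \<and> irreducible F \<and> irreducible G \<and>
           degree F = degree Q \<and> degree G = degree Q \<and>
           (rel_trace (degree Q) F = rel_trace (degree Q) G \<longleftrightarrow> even (degree Q))"
proof -
  define P where "P = Q \<circ>\<^sub>p [:c, 1, 1:]"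
  have Q_pos: "degree Q > 0"
    using field_poly_irreducible_degree_pos[OF Q] .
  have degP: "degree P = 2 * degree Q"
    by (simp add: P_def degree_pcompose)
  have deg_factor: "degree H = degree Q" if "irreducible H" "H dvd P" for H
    using degree_factor_artin_schreier_compose[OF Q] that trace by (simp add: P_def)
  obtain F where F: "irreducible F" "F dvd P"
    using field_poly_irreducible_factor_exists[of P] degP Q_pos by auto
  then obtain G where FG: "P = F * G"
    by (elim dvdE)
  have degF: "degree F = degree Q"
    using deg_factor F .
  moreover have "F \<noteq> 0" "G \<noteq> 0"
    using FG degP Q_pos by auto
  ultimately have degG: "degree G = degree Q"
    using degP by (simp add: FG degree_mult_eq)
  have "degree H = degree G" if "irreducible H" "H dvd G" for H
    using deg_factor[of H] that by (simp add: FG degG)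
  hence G: "irreducible G"
    using degG Q_pos by (intro field_poly_irreducibleI_factor_degree) auto
  have trace_sum: "rel_trace (degree Q) F + rel_trace (degree Q) G = of_nat (degree Q)"
    using rel_trace_sum_artin_schreier_factors[OF Q _ F(1) G] FG degF degG by (simp add: P_def)
  have "rel_trace (degree Q) F = rel_trace (degree Q) G \<longleftrightarrow>
          even (rel_trace (degree Q) F + rel_trace (degree Q) G)"
    by (simp only: Z2.bit_eq_iff even_add)
  hence "rel_trace (degree Q) F = rel_trace (degree Q) G \<longleftrightarrow> even (degree Q)"
    by (simp only: trace_sum even_of_nat_iff)
  thus ?thesis
    using F(1) G FG degF degG unfolding P_def by blast
qed

lemma artin_schreier_compose_monic:
  assumes Q: "Q = monom 1 n + (\<Sum>j<n. monom (\<alpha> j) j)" and irr: "irreducible Q"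
  shows "\<alpha> (n - 1) + of_nat n * c \<noteq> 0 \<Longrightarrow>
           irreducible (Q \<circ>\<^sub>p [:c, 1, 1:]) \<and> degree (Q \<circ>\<^sub>p [:c, 1, 1:]) = 2 * n"
    and "\<alpha> (n - 1) + of_nat n * c = 0 \<Longrightarrow>
           \<exists>F G. Q \<circ>\<^sub>p [:c, 1, 1:] = F * G \<and> irreducible F \<and> irreducible G \<and>
             degree F = n \<and> degree G = n \<and> (rel_trace n F = rel_trace n G \<longleftrightarrow> even n)"
proof -
  have deg: "degree Q = n"
    by (simp only: Q degree_monom_add_lower_terms)
  hence "n > 0"
    using field_poly_irreducible_degree_pos[OF irr] by simp
  hence "next_coeff Q = \<alpha> (n - 1)"
    by (simp only: Q next_coeff_monom_add_lower_terms)
  hence trace: "shifted_trace Q c = \<alpha> (n - 1) + of_nat n * c"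
    by (simp only: shifted_trace_def rel_trace_degree[OF irr] flip: deg)
  show "irreducible (Q \<circ>\<^sub>p [:c, 1, 1:]) \<and> degree (Q \<circ>\<^sub>p [:c, 1, 1:]) = 2 * n"
    if "\<alpha> (n - 1) + of_nat n * c \<noteq> 0"
    using irreducible_artin_schreier_compose[OF irr] that
    by (simp add: trace deg degree_pcompose del: add_bit_eq_xor mult_bit_eq_and)
  show "\<exists>F G. Q \<circ>\<^sub>p [:c, 1, 1:] = F * G \<and> irreducible F \<and> irreducible G \<and>
          degree F = n \<and> degree G = n \<and> (rel_trace n F = rel_trace n G \<longleftrightarrow> even n)"
    if "\<alpha> (n - 1) + of_nat n * c = 0"
    using artin_schreier_compose_splits[OF irr, of c] that unfolding trace deg by blast
qed

theorem theorem2: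
  shows
    "(\<forall>(m :: nat) (\<alpha> :: nat \<Rightarrow> bit) (Q :: bit poly).
        Q = monom 1 (2 * m) + (\<Sum>j<2 * m. monom (\<alpha> j) j) \<longrightarrow> irreducible Q \<longrightarrow>
        (\<alpha> (2 * m - 1) = 1 \<longrightarrow>
          (\<forall>R \<in> {[:0, 1, 1:], [:1, 1, 1:]}.
            irreducible (Q \<circ>\<^sub>p R) \<and> degree (Q \<circ>\<^sub>p R) = 2 * (2 * m))) \<and>
        (\<alpha> (2 * m - 1) = 0 \<longrightarrow>
          (\<forall>R \<in> {[:0, 1, 1:], [:1, 1, 1:]}. \<exists>F G.
            Q \<circ>\<^sub>p R = F * G \<and> irreducible F \<and> irreducible G \<and>
            degree F = 2 * m \<and> degree G = 2 * m \<and>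
            rel_trace (2 * m) F = rel_trace (2 * m) G)))
     \<and>
     (\<forall>(m :: nat) (\<alpha> :: nat \<Rightarrow> bit) (Q :: bit poly).
        Q = monom 1 (2 * m + 1) + (\<Sum>j\<le>2 * m. monom (\<alpha> j) j) \<longrightarrow> irreducible Q \<longrightarrow>
        (irreducible (Q \<circ>\<^sub>p [:1 + \<alpha> (2 * m), 1, 1:]) \<and>
         degree (Q \<circ>\<^sub>p [:1 + \<alpha> (2 * m), 1, 1:]) = 2 * (2 * m + 1)) \<and>
        (\<exists>F G.
          Q \<circ>\<^sub>p [:\<alpha> (2 * m), 1, 1:] = F * G \<and> irreducible F \<and> irreducible G \<and>
          degree F = 2 * m + 1 \<and> degree G = 2 * m + 1 \<and>
          rel_trace (2 * m + 1) F \<noteq> rel_trace (2 * m + 1) G))"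
proof (intro conjI allI impI)
  fix m :: nat and \<alpha> :: "nat \<Rightarrow> bit" and Q :: "bit poly"
  assume "Q = monom 1 (2 * m) + (\<Sum>j<2 * m. monom (\<alpha> j) j)" "irreducible Q"
  note dichotomy = artin_schreier_compose_monic[OF this]
  show "\<forall>R \<in> {[:0, 1, 1:], [:1, 1, 1:]}.
          irreducible (Q \<circ>\<^sub>p R) \<and> degree (Q \<circ>\<^sub>p R) = 2 * (2 * m)" if "\<alpha> (2 * m - 1) = 1"
    using dichotomy(1) that by simp
  show "\<forall>R \<in> {[:0, 1, 1:], [:1, 1, 1:]}. \<exists>F G.
          Q \<circ>\<^sub>p R = F * G \<and> irreducible F \<and> irreducible G \<and>
          degree F = 2 * m \<and> degree G = 2 * m \<and>
          rel_trace (2 * m) F = rel_trace (2 * m) G" if "\<alpha> (2 * m - 1) = 0"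
    using dichotomy(2) that by simp
next
  fix m :: nat and \<alpha> :: "nat \<Rightarrow> bit" and Q :: "bit poly"
  assume "Q = monom 1 (2 * m + 1) + (\<Sum>j\<le>2 * m. monom (\<alpha> j) j)" "irreducible Q"
  hence "Q = monom 1 (2 * m + 1) + (\<Sum>j<2 * m + 1. monom (\<alpha> j) j)" "irreducible Q"
    by (simp_all add: lessThan_Suc_atMost)
  note dichotomy = artin_schreier_compose_monic[OF this]
  show "irreducible (Q \<circ>\<^sub>p [:1 + \<alpha> (2 * m), 1, 1:])"
    and "degree (Q \<circ>\<^sub>p [:1 + \<alpha> (2 * m), 1, 1:]) = 2 * (2 * m + 1)"
    using dichotomy(1)[of "1 + \<alpha> (2 * m)"] by simp_all
  show "\<exists>F G. Q \<circ>\<^sub>p [:\<alpha> (2 * m), 1, 1:] = F * G \<and> irreducible F \<and> irreducible G \<and>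
          degree F = 2 * m + 1 \<and> degree G = 2 * m + 1 \<and>
          rel_trace (2 * m + 1) F \<noteq> rel_trace (2 * m + 1) G"
    using dichotomy(2)[of "\<alpha> (2 * m)"] by simp
qed

end
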